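(* Let $X$ be a set, let $\mathcal{L}$ be a Lattice of subsets of $X$ containing $\emptyset$ and $X$, let $\sigma(\mathcal{L})$ be the Lattice $\sigma$-algebra generated by $\mathcal{L}$, and let $\nu$ be a signed Lattice measure on $(X,\sigma(\mathcal{L}))$. Then: (i) every sublattice of a positive Lattice is a positive Lattice, i.e. if $A\in\sigma(\mathcal{L})$ is a positive Lattice and $E\in\sigma(\mathcal{L})$ satisfies $E\le A$, then $E$ is a positive Lattice; and (ii) any countable union of positive Lattices is a positive Lattice, i.e. if $(A_n)$ is a countable family of positive Lattices in $\sigma(\mathcal{L})$, then $\bigvee_n A_n$ is a positive Lattice.
   Context: Lattices. Throughout, "Lattice" means a complete lattice $(L,\wedge,\vee)$ with order $\le$, minimum $0$ and maximum $I$, equipped with an operator $x\mapsto x^C$, satisfying the commutative, associative and absorption laws; the distributive laws $x\vee(y\wedge z)=(x\vee y)\wedge(x\vee z)$ and $x\wedge(y\vee z)=(x\wedge y)\vee(x\wedge z)$; the law of excluded middle $x\vee x^C=I$; the law of contrapositive $x\le y\Rightarrow x^C\ge y^C$; and the law of double negation $(x^C)^C=x$. The law of non-contradiction $x\wedge x^C=0$ is not included among the axioms. Here the elements are subsets of $X$, the minimum $0$ is $\emptyset$ and the maximum $I$ is $X$; the operations $\wedge,\vee,{}^C$ and the order $\le$ are those of the Lattice. Lattice $\sigma$-algebra. A Lattice $\mathcal{L}$ of subsets of $X$ is a Lattice $\sigma$-algebra if (1) $h\in\mathcal{L}$ implies $h^C\in\mathcal{L}$; and (2) $h_n\in\mathcal{L}$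 for $n=1,2,3,\dots$ implies $\bigvee_{n=1}^\infty h_n\in\mathcal{L}$. $\sigma(\mathcal{L})$ denotes the Lattice $\sigma$-algebra generated by $\mathcal{L}$. Elements of $\sigma(\mathcal{L})$ are called measurable Lattices (so the word "Lattice" is also used for an individual element). Signed Lattice measure. A signed Lattice measure on $(X,\sigma(\mathcal{L}))$ is a map $\nu:\sigma(\mathcal{L})\to\mathbb{R}\cup\{\infty\}$ or $\nu:\sigma(\mathcal{L})\to\mathbb{R}\cup\{-\infty\}$ such that: (1) $\nu(\emptyset)=\nu(0)=0$; (2) for all $h,g\in\sigma(\mathcal{L})$ with $\nu(h),\nu(g)\ge 0$: $h\le g\Rightarrow\nu(h)\le\nu(g)$; and for all $h,g\in\sigma(\mathcal{L})$ with $\nu(h),\nu(g)\le 0$: $h\le g\Rightarrow\nu(g)\le\nu(h)$; (3) for all $h,g\in\sigma(\mathcal{L})$: $\nu(h\vee g)+\nu(h\wedge g)=\nu(h)+\nu(g)$; (4) if $h_n\in\sigma(\mathcal{L})$, $n\in\mathbb{N}$, with $h_1\le h_2\le\cdots\le h_n\le\cdots$, then $\nu(\bigvee_{n=1}^\infty h_n)=\lim_{n\to\infty}\nu(h_n)$, in the sense that if the left side is finite the limit converges to it, and if the left side is $\pm\infty$ the limit diverges accordingly. Positive Lattices. $A\in\sigma(\mathcal{L})$ is a positive Lattice if $\nu(E)\ge 0$ for every $E\in\sigma(\mathcal{L})$ with $E\le A$. *)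

theory Defs
  imports "HOL-Algebra.Complete_Lattice" "HOL-Library.Extended_Real"
begin

record 'a complemented_gorder = "'a gorder" +
  lcompl :: "'a \<Rightarrow> 'a"

text \<open>
  The commutative, associative and absorption laws already hold in any \<^locale>\<open>complete_lattice\<close>.
  Non-contradiction is not an axiom; it follows, since \<open>lcompl L\<close> is an order-reversing involution.
\<close>

locale complemented_complete_lattice = complete_lattice L
  for L (structure) +
  assumes lcompl_closed: "x \<in> carrier L \<Longrightarrow> lcompl L x \<in> carrier L"
    and join_meet_distrib:
      "\<lbrakk>x \<in> carrier L; y \<in> carrier L; z \<in> carrier L\<rbrakk>
        \<Longrightarrow> x \<squnion> (y \<sqinter> z) = (x \<squnion> y) \<sqinter> (x \<squnion> z)"
    and meet_join_distrib:
      "\<lbrakk>x \<in> carrier L; y \<in> carrier L; z \<in> carrier L\<rbrakk>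
        \<Longrightarrow> x \<sqinter> (y \<squnion> z) = (x \<sqinter> y) \<squnion> (x \<sqinter> z)"
    and excluded_middle: "x \<in> carrier L \<Longrightarrow> x \<squnion> lcompl L x = \<top>"
    and contrapositive:
      "\<lbrakk>x \<in> carrier L; y \<in> carrier L; x \<sqsubseteq> y\<rbrakk> \<Longrightarrow> lcompl L y \<sqsubseteq> lcompl L x"
    and double_negation: "x \<in> carrier L \<Longrightarrow> lcompl L (lcompl L x) = x"

text \<open>
  The elements are subsets of \<open>X\<close>, with minimum \<open>{}\<close> and maximum \<open>X\<close>. The order, and with it
  join, meet and complement, is that of the lattice and need not be set inclusion.
\<close>

locale lattice_of_sets = complemented_complete_lattice L
  for X :: "'a set" and L :: "('a set, 'm) complemented_gorder_scheme" (structure) +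
  assumes carrier_subsets: "carrier L \<subseteq> Pow X"
    and bottom_empty: "\<bottom> = {}"
    and top_space: "\<top> = X"

text \<open>
  Below, \<open>U\<close> is the surrounding lattice supplying the operations. Without one, the
  \<open>\<sigma>\<close>-algebra generated by a collection would not make sense, since the order on subsets is
  not given by inclusion. Taking \<open>M = carrier U\<close> recovers \<open>U\<close> itself.
\<close>

definition sublattice_of_sets ::
    "'a set \<Rightarrow> ('a set, 'm) complemented_gorder_scheme \<Rightarrow> 'a set set \<Rightarrow> bool" where
  "sublattice_of_sets X U M \<longleftrightarrow>
     M \<subseteq> carrier U \<and> {} \<in> M \<and> X \<in> M \<and>
     (\<forall>h\<in>M. \<forall>g\<in>M. h \<squnion>\<^bsub>U\<^esub> g \<in> M \<and> h \<sqinter>\<^bsub>U\<^esub> g \<in> M)"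

definition lattice_sigma_algebra ::
    "'a set \<Rightarrow> ('a set, 'm) complemented_gorder_scheme \<Rightarrow> 'a set set \<Rightarrow> bool" where
  "lattice_sigma_algebra X U M \<longleftrightarrow>
     sublattice_of_sets X U M \<and>
     (\<forall>h\<in>M. lcompl U h \<in> M) \<and>
     (\<forall>h :: nat \<Rightarrow> 'a set. (\<forall>n. h n \<in> M) \<longrightarrow> \<Squnion>\<^bsub>U\<^esub>(range h) \<in> M)"

definition lattice_sigma ::
    "'a set \<Rightarrow> ('a set, 'm) complemented_gorder_scheme \<Rightarrow> 'a set set \<Rightarrow> 'a set set" where
  "lattice_sigma X U M = \<Inter>{S. lattice_sigma_algebra X U S \<and> M \<subseteq> S}"

text \<open>
  Only the values of \<open>\<nu>\<close> on \<open>S\<close> matter. The first conjunct says that \<open>\<nu>\<close> omits one of the two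
  infinite values on \<open>S\<close>, so the extended-real sums below are never of the form \<open>\<infinity> - \<infinity>\<close>.
\<close>

definition signed_lattice_measure ::
    "('a set, 'm) complemented_gorder_scheme \<Rightarrow> 'a set set \<Rightarrow> ('a set \<Rightarrow> ereal) \<Rightarrow> bool" where
  "signed_lattice_measure U S \<nu> \<longleftrightarrow>
     ((\<forall>h\<in>S. \<nu> h \<noteq> -\<infinity>) \<or> (\<forall>h\<in>S. \<nu> h \<noteq> \<infinity>)) \<and>
     \<nu> {} = 0 \<and>
     (\<forall>h\<in>S. \<forall>g\<in>S. 0 \<le> \<nu> h \<and> 0 \<le> \<nu> g \<and> h \<sqsubseteq>\<^bsub>U\<^esub> g \<longrightarrow> \<nu> h \<le> \<nu> g) \<and>
     (\<forall>h\<in>S. \<forall>g\<in>S. \<nu> h \<le> 0 \<and> \<nu> g \<le> 0 \<and> h \<sqsubseteq>\<^bsub>U\<^esub> g \<longrightarrow> \<nu> g \<le> \<nu> h) \<and>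
     (\<forall>h\<in>S. \<forall>g\<in>S. \<nu> (h \<squnion>\<^bsub>U\<^esub> g) + \<nu> (h \<sqinter>\<^bsub>U\<^esub> g) = \<nu> h + \<nu> g) \<and>
     (\<forall>h :: nat \<Rightarrow> 'a set.
        (\<forall>n. h n \<in> S) \<and> (\<forall>n. h n \<sqsubseteq>\<^bsub>U\<^esub> h (Suc n)) \<longrightarrow>
        (\<lambda>n. \<nu> (h n)) \<longlonglongrightarrow> \<nu> (\<Squnion>\<^bsub>U\<^esub>(range h)))"

definition positive_lattice ::
    "('a set, 'm) complemented_gorder_scheme \<Rightarrow> 'a set set \<Rightarrow> ('a set \<Rightarrow> ereal) \<Rightarrow> 'a set \<Rightarrow> bool"
  where
  "positive_lattice U S \<nu> A \<longleftrightarrow> A \<in> S \<and> (\<forall>E\<in>S. E \<sqsubseteq>\<^bsub>U\<^esub> A \<longrightarrow> 0 \<le> \<nu> E)"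

end

theory Submission
  imports Defs
begin

text \<open>
  Subtracting \<open>\<nu> (h \<sqinter> g)\<close> in the modularity law is not allowed when it is infinite. Since the
  complement is in fact Boolean, any \<open>E\<close> below \<open>A \<squnion> B\<close> is instead split into the disjoint
  pieces \<open>E \<sqinter> A\<close> and \<open>E \<sqinter> B \<sqinter> A\<^sup>C\<close>, on which \<open>\<nu>\<close> is nonnegative and adds up; so
  finite joins of positive lattices are positive. For a sequence, \<open>E\<close> is the
  supremum of its meets with the partial joins (infinite distributivity holds in a complete
  Boolean algebra), and \<open>\<nu> E\<close> is a limit of nonnegative numbers.
\<close>

section \<open>Boolean complement and infinite distributivity\<close>

context complemented_complete_lattice
begin

text \<open>Any \<open>x\<close> is the complement of \<open>lcompl L x\<close>, which lies below
  the top, so contraposition puts \<open>lcompl L \<top>\<close> below \<open>x\<close>.\<close>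

lemma lcompl_top: "lcompl L \<top> = \<bottom>"
proof (rule bottom_weak_eq[unfolded eq_is_equal])
  show "lcompl L \<top> \<in> carrier L" by (simp add: lcompl_closed)
next
  fix x assume x: "x \<in> carrier L"
  then have "lcompl L x \<sqsubseteq> \<top>" by (simp add: lcompl_closed top_higher)
  then show "lcompl L \<top> \<sqsubseteq> x"
    using contrapositive[of "lcompl L x" \<top>] x by (simp add: lcompl_closed double_negation)
qed

text \<open>Derives non-contradiction from excluded middle by duality: the complement of the meet
  lies above both \<open>lcompl L x\<close> and \<open>x\<close>, hence is the top, and
  complementing once more gives the bottom.\<close>

lemma meet_lcompl:
  assumes x: "x \<in> carrier L"
  shows "x \<sqinter> lcompl L x = \<bottom>"
proof -
  let ?y = "x \<sqinter> lcompl L x"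
  have c: "lcompl L x \<in> carrier L" and y: "?y \<in> carrier L"
    using x by (simp_all add: lcompl_closed)
  then have cy: "lcompl L ?y \<in> carrier L" by (simp add: lcompl_closed)
  have "lcompl L x \<sqsubseteq> lcompl L ?y"
    using contrapositive[OF y x] meet_left[OF x c] by simp
  moreover have "x \<sqsubseteq> lcompl L ?y"
    using contrapositive[OF y c] meet_right[OF x c] x by (simp add: double_negation)
  ultimately have "x \<squnion> lcompl L x \<sqsubseteq> lcompl L ?y"
    using x c cy by (intro join_le)
  then have "lcompl L ?y = \<top>"
    using x cy by (simp add: excluded_middle le_antisym top_higher)
  then show ?thesis
    using double_negation[OF y] lcompl_top by simp
qed

text \<open>One half of the adjunction between meeting with \<open>x\<close> and joining with
  \<open>lcompl L x\<close>. By excluded middle \<open>y\<close> lies below both factors of a meet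
  that distributivity turns into \<open>lcompl L x \<squnion> (x \<sqinter> y)\<close>.\<close>

lemma meet_le_imp_le_join_lcompl:
  assumes x: "x \<in> carrier L" and y: "y \<in> carrier L" and z: "z \<in> carrier L"
    and le: "x \<sqinter> y \<sqsubseteq> z"
  shows "y \<sqsubseteq> lcompl L x \<squnion> z"
proof -
  have c: "lcompl L x \<in> carrier L" using x by (rule lcompl_closed)
  have "y \<sqsubseteq> \<top>" using y by (rule top_higher)
  also have "\<top> = lcompl L x \<squnion> x"
    using excluded_middle[OF x] by (simp add: join_comm)
  finally have "y \<sqsubseteq> (lcompl L x \<squnion> x) \<sqinter> (lcompl L x \<squnion> y)"
    using x y c by (intro meet_le join_right) simp_all
  also have "\<dots> = lcompl L x \<squnion> (x \<sqinter> y)"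
    using x y c by (simp add: join_meet_distrib)
  also have "\<dots> \<sqsubseteq> lcompl L x \<squnion> z"
    using x y z c le by (meson join_closed join_le join_left join_right le_trans meet_closed)
  finally show ?thesis using x y z c by simp
qed

text \<open>The other half: distributing \<open>x\<close> over the join, the summand
  \<open>x \<sqinter> lcompl L x\<close> vanishes by non-contradiction.\<close>

lemma le_join_lcompl_imp_meet_le:
  assumes x: "x \<in> carrier L" and y: "y \<in> carrier L" and z: "z \<in> carrier L"
    and le: "y \<sqsubseteq> lcompl L x \<squnion> z"
  shows "x \<sqinter> y \<sqsubseteq> z"
proof -
  have c: "lcompl L x \<in> carrier L" using x by (rule lcompl_closed)
  have "x \<sqinter> y \<sqsubseteq> x \<sqinter> (lcompl L x \<squnion> z)"
    using x y z c le by (meson join_closed le_trans meet_closed meet_le meet_left meet_right)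
  also have "\<dots> = \<bottom> \<squnion> (x \<sqinter> z)"
    using x z c by (simp add: meet_join_distrib meet_lcompl)
  also have "\<dots> \<sqsubseteq> z"
    using x z by (simp add: join_le bottom_lower meet_right)
  finally show ?thesis using x y z c by simp
qed

text \<open>Meeting with \<open>x\<close> is a left adjoint and so preserves suprema. The adjunction
  moves \<open>x\<close> across the inequality, where \<open>sup_least\<close> applies to
  \<open>A\<close> itself, and then moves it back.\<close>

lemma meet_sup_distrib:
  assumes x: "x \<in> carrier L" and A: "A \<subseteq> carrier L"
  shows "x \<sqinter> \<Squnion>A = \<Squnion>((\<lambda>a. x \<sqinter> a) ` A)"
proof (rule le_antisym)
  let ?z = "\<Squnion>((\<lambda>a. x \<sqinter> a) ` A)"
  have xA: "(\<lambda>a. x \<sqinter> a) ` A \<subseteq> carrier L" using x A by auto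
  then show z: "?z \<in> carrier L" by simp
  have sA: "\<Squnion>A \<in> carrier L" using A by simp
  then show xsA: "x \<sqinter> \<Squnion>A \<in> carrier L" using x by simp
  have c: "lcompl L x \<in> carrier L" using x by (rule lcompl_closed)
  have "a \<sqsubseteq> lcompl L x \<squnion> ?z" if "a \<in> A" for a
    using that x A z xA by (intro meet_le_imp_le_join_lcompl sup_upper) auto
  then have "\<Squnion>A \<sqsubseteq> lcompl L x \<squnion> ?z"
    using A c z by (intro sup_least) simp_all
  then show "x \<sqinter> \<Squnion>A \<sqsubseteq> ?z"
    using x sA z by (intro le_join_lcompl_imp_meet_le)
  have "x \<sqinter> a \<sqsubseteq> x \<sqinter> \<Squnion>A" if "a \<in> A" for a
  proof -
    have a: "a \<in> carrier L" using that A by auto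
    have "x \<sqinter> a \<sqsubseteq> \<Squnion>A"
      using le_trans[OF meet_right[OF x a] sup_upper[OF A that]] x a sA by simp
    then show ?thesis using x a sA by (simp add: meet_le meet_left)
  qed
  then show "?z \<sqsubseteq> x \<sqinter> \<Squnion>A"
    using xA xsA by (intro sup_least) auto
qed

end

section \<open>The generated sigma-algebra\<close>

context lattice_of_sets
begin

text \<open>Shows that the family intersected in \<open>lattice_sigma\<close> is nonempty, which
  keeps the intersection inside the carrier.\<close>

lemma lattice_sigma_algebra_carrier: "lattice_sigma_algebra X L (carrier L)"
  unfolding lattice_sigma_algebra_def sublattice_of_sets_def
  using bottom_closed top_closed bottom_empty top_space
  by (auto simp: lcompl_closed intro!: sup_closed)

lemma lattice_sigma_algebra_lattice_sigma:
  assumes "sublattice_of_sets X L M"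
  shows "lattice_sigma_algebra X L (lattice_sigma X L M)"
proof -
  have "carrier L \<in> {S. lattice_sigma_algebra X L S \<and> M \<subseteq> S}"
    using assms lattice_sigma_algebra_carrier by (simp add: sublattice_of_sets_def)
  then show ?thesis
    unfolding lattice_sigma_def lattice_sigma_algebra_def sublattice_of_sets_def
    by blast
qed

end

section \<open>Positive lattices of a signed lattice measure\<close>

locale signed_lattice_measure_space = lattice_of_sets X L
  for X :: "'a set" and L :: "('a set, 'm) complemented_gorder_scheme" (structure) +
  fixes S :: "'a set set" and \<nu> :: "'a set \<Rightarrow> ereal"
  assumes sigma_algebra: "lattice_sigma_algebra X L S"
    and signed_measure: "signed_lattice_measure L S \<nu>"
begin

lemma carrierI: "h \<in> S \<Longrightarrow> h \<in> carrier L"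
  and empty_in: "{} \<in> S"
  and join_in: "\<lbrakk>h \<in> S; g \<in> S\<rbrakk> \<Longrightarrow> h \<squnion> g \<in> S"
  and meet_in: "\<lbrakk>h \<in> S; g \<in> S\<rbrakk> \<Longrightarrow> h \<sqinter> g \<in> S"
  and lcompl_in: "h \<in> S \<Longrightarrow> lcompl L h \<in> S"
  and sup_in: "(\<And>n. H n \<in> S) \<Longrightarrow> \<Squnion>(range (H :: nat \<Rightarrow> 'a set)) \<in> S"
  using sigma_algebra unfolding lattice_sigma_algebra_def sublattice_of_sets_def by auto

lemma measure_empty: "\<nu> {} = 0"
  and measure_modular: "\<lbrakk>h \<in> S; g \<in> S\<rbrakk> \<Longrightarrow> \<nu> (h \<squnion> g) + \<nu> (h \<sqinter> g) = \<nu> h + \<nu> g"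
  and measure_tendsto_sup:
    "\<lbrakk>\<And>n. H n \<in> S; \<And>n. H n \<sqsubseteq> H (Suc n)\<rbrakk> \<Longrightarrow> (\<lambda>n. \<nu> (H n)) \<longlonglongrightarrow> \<nu> (\<Squnion>(range H))"
  using signed_measure unfolding signed_lattice_measure_def by auto

lemma measure_disjoint_join:
  assumes "h \<in> S" and "g \<in> S" and "h \<sqinter> g = \<bottom>"
  shows "\<nu> (h \<squnion> g) = \<nu> h + \<nu> g"
  using measure_modular[OF assms(1,2)] assms(3) by (simp add: bottom_empty measure_empty)

lemma positive_lattice_mono:
  assumes A: "positive_lattice L S \<nu> A" and E: "E \<in> S" and EA: "E \<sqsubseteq> A"
  shows "positive_lattice L S \<nu> E"
proof -
  have "F \<sqsubseteq> A" if "F \<in> S" "F \<sqsubseteq> E" for F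
    using that A E EA le_trans[of F E A] carrierI by (auto simp: positive_lattice_def)
  then show ?thesis using A E by (auto simp: positive_lattice_def)
qed

text \<open>Serves the join of an empty family: \<open>{}\<close> is the bottom, so nothing else
  lies below it.\<close>

lemma positive_lattice_empty: "positive_lattice L S \<nu> {}"
proof -
  have "E = {}" if "E \<in> S" "E \<sqsubseteq> {}" for E
    using that carrierI[of E] bottom_lower[of E] bottom_closed
    by (metis bottom_empty le_antisym)
  then have "0 \<le> \<nu> E" if "E \<in> S" "E \<sqsubseteq> {}" for E
    using that measure_empty by (metis order_refl)
  then show ?thesis
    by (simp add: positive_lattice_def empty_in)
qed

lemma positive_lattice_join:
  assumes A: "positive_lattice L S \<nu> A" and B: "positive_lattice L S \<nu> B"
  shows "positive_lattice L S \<nu> (A \<squnion> B)"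
proof -
  have AS: "A \<in> S" and BS: "B \<in> S" using A B by (auto simp: positive_lattice_def)
  note Ac = carrierI[OF AS] and Bc = carrierI[OF BS]
  have "0 \<le> \<nu> E" if ES: "E \<in> S" and le: "E \<sqsubseteq> A \<squnion> B" for E
  proof -
    note Ec = carrierI[OF ES]
    let ?C = "lcompl L A" and ?P = "E \<sqinter> A" and ?Q = "E \<sqinter> lcompl L A"
    have CS: "?C \<in> S" using AS by (rule lcompl_in)
    note Cc = carrierI[OF CS]
    have PS: "?P \<in> S" and QS: "?Q \<in> S" using ES AS CS by (simp_all add: meet_in)
    note Pc = carrierI[OF PS] and Qc = carrierI[OF QS]
    \<comment> \<open>By excluded middle this is a meet with the top.\<close>
    have "E = E \<sqinter> (A \<squnion> ?C)"
      using Ec by (simp add: Ac excluded_middle le_iff_join[symmetric] top_higher)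
    also have "\<dots> = ?P \<squnion> ?Q" using Ec Ac Cc by (rule meet_join_distrib)
    finally have split: "E = ?P \<squnion> ?Q" .
    have "?P \<sqinter> ?Q \<sqsubseteq> A \<sqinter> ?C"
      using le_trans[OF meet_left[OF Pc Qc] meet_right[OF Ec Ac]]
        le_trans[OF meet_right[OF Pc Qc] meet_right[OF Ec Cc]] Pc Qc Ac Cc
      by (simp add: meet_le)
    then have "?P \<sqinter> ?Q = \<bottom>"
      using Pc Qc by (simp add: meet_lcompl Ac bottom_lower le_antisym)
    then have "\<nu> E = \<nu> ?P + \<nu> ?Q"
      using measure_disjoint_join[OF PS QS] split by simp
    moreover have "0 \<le> \<nu> ?P"
      using A PS meet_right[OF Ec Ac] by (simp add: positive_lattice_def)
    \<comment> \<open>Since \<open>A\<close> is the complement of \<open>?C\<close>, the bound on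
      \<open>E\<close> reads as \<open>lcompl L ?C \<squnion> B\<close>, and the adjunction for
      \<open>?C\<close> removes the part in \<open>A\<close>. Thus \<open>?Q\<close> needs no
      explicit meet with \<open>B\<close>.\<close>
    moreover have "?Q \<sqsubseteq> B"
    proof -
      have "E \<sqsubseteq> lcompl L ?C \<squnion> B" using le by (simp add: double_negation Ac)
      then have "?C \<sqinter> E \<sqsubseteq> B" by (rule le_join_lcompl_imp_meet_le[OF Cc Ec Bc])
      then show ?thesis by (simp add: meet_comm)
    qed
    then have "0 \<le> \<nu> ?Q"
      using B QS by (simp add: positive_lattice_def)
    ultimately show ?thesis by simp
  qed
  then show ?thesis using AS BS by (simp add: positive_lattice_def join_in)
qed

lemma positive_lattice_sup_incseq:
  fixes H :: "nat \<Rightarrow> 'a set"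
  assumes pos: "\<And>n. positive_lattice L S \<nu> (H n)" and mono: "\<And>n. H n \<sqsubseteq> H (Suc n)"
  shows "positive_lattice L S \<nu> (\<Squnion>(range H))"
proof -
  have HS: "H n \<in> S" for n using pos by (simp add: positive_lattice_def)
  note Hc = carrierI[OF HS]
  have "0 \<le> \<nu> E" if ES: "E \<in> S" and le: "E \<sqsubseteq> \<Squnion>(range H)" for E
  proof -
    note Ec = carrierI[OF ES]
    let ?G = "\<lambda>n. E \<sqinter> H n"
    have GS: "?G n \<in> S" for n using ES HS by (rule meet_in)
    have "?G n \<sqsubseteq> ?G (Suc n)" for n
      using le_trans[OF meet_right[OF Ec Hc] mono] Ec Hc by (simp add: meet_le meet_left)
    then have lim: "(\<lambda>n. \<nu> (?G n)) \<longlonglongrightarrow> \<nu> (\<Squnion>(range ?G))"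
      by (rule measure_tendsto_sup[OF GS])
    have Hr: "range H \<subseteq> carrier L" using Hc by auto
    \<comment> \<open>Writes \<open>E\<close> as the supremum of an increasing sequence in
      \<open>S\<close>, to which continuity from below applies.\<close>
    then have "E = E \<sqinter> \<Squnion>(range H)"
      using le Ec by (simp add: le_iff_join)
    also have "\<dots> = \<Squnion>(range ?G)"
      using meet_sup_distrib[OF Ec Hr] by (simp add: image_image)
    finally have E: "E = \<Squnion>(range ?G)" .
    have "0 \<le> \<nu> (?G n)" for n
      using pos[of n] GS meet_right[OF Ec Hc] by (simp add: positive_lattice_def)
    then have "0 \<le> \<nu> (\<Squnion>(range ?G))"
      by (intro LIMSEQ_le_const[OF lim]) auto
    then show ?thesis using E by simp
  qed
  then show ?thesis using HS by (simp add: positive_lattice_def sup_in)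
qed

lemma positive_lattice_sup_sequence:
  fixes A :: "nat \<Rightarrow> 'a set"
  assumes pos: "\<And>n. positive_lattice L S \<nu> (A n)"
  shows "positive_lattice L S \<nu> (\<Squnion>(range A))"
proof -
  \<comment> \<open>\<open>H n\<close> is the join of \<open>A 0\<close> up to and including
    \<open>A n\<close>: increasing, and positive by the binary case.\<close>
  define H where "H = rec_nat (A 0) (\<lambda>n h. h \<squnion> A (Suc n))"
  have H0: "H 0 = A 0" and HSuc: "H (Suc n) = H n \<squnion> A (Suc n)" for n
    by (simp_all add: H_def)
  have AS: "A n \<in> S" for n using pos by (simp add: positive_lattice_def)
  note Ac = carrierI[OF AS]
  have Hpos: "positive_lattice L S \<nu> (H n)" for n
    by (induction n) (simp_all add: H0 HSuc pos positive_lattice_join)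
  then have HS: "H n \<in> S" for n by (simp add: positive_lattice_def)
  note Hc = carrierI[OF HS]
  have sup_pos: "positive_lattice L S \<nu> (\<Squnion>(range H))"
    using Hpos by (rule positive_lattice_sup_incseq) (simp add: HSuc join_left Hc Ac)
  have "A n \<sqsubseteq> H n" for n
    by (cases n) (simp_all add: H0 HSuc join_right Hc Ac)
  moreover have Hr: "range H \<subseteq> carrier L" and Ar: "range A \<subseteq> carrier L"
    using Hc Ac by auto
  ultimately have "A n \<sqsubseteq> \<Squnion>(range H)" for n
    using le_trans[of "A n" "H n" "\<Squnion>(range H)"] sup_upper[OF Hr, of "H n"] Hc Ac by simp
  \<comment> \<open>This inequality suffices, as positivity passes to smaller elements of
    \<open>S\<close>.\<close>
  then have "\<Squnion>(range A) \<sqsubseteq> \<Squnion>(range H)"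
    using Hr Ar by (intro sup_least) auto
  then show ?thesis
    using positive_lattice_mono[OF sup_pos] sup_in[OF AS] by simp
qed

lemma positive_lattice_sup_countable:
  assumes "countable I" and pos: "\<And>i. i \<in> I \<Longrightarrow> positive_lattice L S \<nu> (A i)"
  shows "positive_lattice L S \<nu> (\<Squnion>(A ` I))"
proof (cases "I = {}")
  case True
  have "\<Squnion>{} = {}" using weak_sup_empty by (simp add: eq_is_equal bottom_empty)
  then show ?thesis using True by (simp add: positive_lattice_empty)
next
  case False
  \<comment> \<open>\<open>from_nat_into\<close> enumerates the nonempty index set, possibly with
    repetitions; the join depends only on the image.\<close>
  then have "A ` I = range (\<lambda>n. A (from_nat_into I n))"
    using range_from_nat_into[OF False \<open>countable I\<close>] by (metis image_image)
  then show ?thesis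
    using positive_lattice_sup_sequence[of "\<lambda>n. A (from_nat_into I n)"]
      pos from_nat_into[OF False] by simp
qed

end

theorem lemma1:
  fixes X :: "'a set"
    and U :: "('a set, 'm) complemented_gorder_scheme"
    and \<L> :: "'a set set"
    and \<nu> :: "'a set \<Rightarrow> ereal"
  assumes "lattice_of_sets X U"
    and "sublattice_of_sets X U \<L>"
    and "signed_lattice_measure U (lattice_sigma X U \<L>) \<nu>"
  shows "(\<forall>A E. positive_lattice U (lattice_sigma X U \<L>) \<nu> A \<and>
                E \<in> lattice_sigma X U \<L> \<and> E \<sqsubseteq>\<^bsub>U\<^esub> A \<longrightarrow>
                positive_lattice U (lattice_sigma X U \<L>) \<nu> E) \<and>
         (\<forall>(I :: 'i set) (A :: 'i \<Rightarrow> 'a set). countable I \<and>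
                (\<forall>i\<in>I. positive_lattice U (lattice_sigma X U \<L>) \<nu> (A i)) \<longrightarrow>
                positive_lattice U (lattice_sigma X U \<L>) \<nu> (\<Squnion>\<^bsub>U\<^esub>(A ` I)))"
proof -
  interpret lattice_of_sets X U by fact
  interpret signed_lattice_measure_space X U "lattice_sigma X U \<L>" \<nu>
    using assms by unfold_locales (simp_all add: lattice_sigma_algebra_lattice_sigma)
  show ?thesis
    using positive_lattice_mono positive_lattice_sup_countable by blast
qed

end
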